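(* Let $K\ge 2$ and $L\ge 0$ be integers with $L\le B_K$, where $B_K=\frac{K-\sqrt{3K-2}}{2}$ if $K$ is even and $B_K=\frac{K-\sqrt{3K}}{2}$ if $K$ is odd. Then there exists a symmetric invariant design $\bar\xi^*$ on $\mathcal{X}_{L,K-L}$ which is supported on at most three symmetric orbits contained in $\mathcal{X}_{L,K-L}$ and whose information matrix satisfies $\mathbf{M}(\bar\xi^* )=\mathbf{I}_p$, the $p\times p$ identity matrix.
   Context: Model: for $\bm{x}=(x_1,\dots,x_K)^\top\in\{-1,+1\}^K$ let $\bm{f}(\bm{x})=(1,\,x_1,\dots,x_K,\,x_1x_2,\dots,x_{K-1}x_K)^\top\in\mathbb{R}^p$ (constant, main effects $x_k$, and all two-factor interactions $x_jx_k$, $j<k$), so $p=1+K(K+1)/2$. A design $\xi$ is a probability measure on $\{-1,+1\}^K$ (finitely many points $\bm{x}_i$ with weights $w_i\ge 0$, $\sum_i w_i=1$); its information matrix is $\mathbf{M}(\xi)=\sum_i w_i\,\bm{f}(\bm{x}_i)\bm{f}(\bm{x}_i)^\top$. A design on a region $\mathcal{X}\subseteq\{-1,+1\}^K$ is a design whose support is contained in $\mathcal{X}$. Let $d(\bm{x})$ be the number of entries of $\bm{x}$ equal to $+1$, and $\mathcal{X}_{L,U}=\{\bm{x}\in\{-1,+1\}^K:\ L\le d(\bm{x})\le U\}$. For $0\le k\le K$ let $\mathcal{O}_k=\{\bm{x}: d(\bm{x})=k\}$ and let $\bar\xi_k$ be the uniform design on $\mathcal{O}_k$. For $0\le k\le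 K/2$ the symmetric orbit is $\tilde{\mathcal{O}}_k=\mathcal{O}_k\cup\mathcal{O}_{K-k}$. A symmetric invariant design is one of the form $\bar\xi=\sum_{k=0}^K\bar w_k\bar\xi_k$ with $\bar w_k\ge0$, $\sum_k\bar w_k=1$ and $\bar w_k=\bar w_{K-k}$ for all $k$; it is supported on the symmetric orbits $\tilde{\mathcal{O}}_k$ with $\bar w_k>0$. *)

theory Defs
  imports "HOL-Probability.Probability_Mass_Function" "Jordan_Normal_Form.Matrix"
begin

unbundle no vec_syntax

text \<open>Coordinates are indexed from \<open>0\<close>, so the points of \<open>cube K\<close> are the vectors
  \<open>(x $ 0, \<dots>, x $ (K - 1))\<close> with entries \<open>-1\<close> and \<open>1\<close>.\<close>

definition cube :: "nat \<Rightarrow> real Matrix.vec set" where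
  "cube K = {x \<in> carrier_vec K. \<forall>i<K. x $ i \<in> {-1, 1}}"

definition regression :: "real Matrix.vec \<Rightarrow> real Matrix.vec" where
  "regression x = vec_of_list
     (1 # list_of_vec x @
      [x $ i * x $ j. i \<leftarrow> [0..<dim_vec x], j \<leftarrow> [Suc i..<dim_vec x]])"

definition num_params :: "nat \<Rightarrow> nat" where
  "num_params K = 1 + K * (K + 1) div 2"

lemma dim_regression:
  assumes "x \<in> carrier_vec K"
  shows "dim_vec (regression x) = num_params K"
proof -
  have *: "sum_list (map (\<lambda>i. K - Suc i) [0..<K]) = K * (K - 1) div 2"
  proof -
    have "sum_list (map (\<lambda>i. K - Suc i) [0..<K]) = (\<Sum>i<K. K - Suc i)"
      by (simp add: sum_list_sum_nth atLeast0LessThan)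
    also have "\<dots> = (\<Sum>i<K. i)"
      by (rule sum.nat_diff_reindex)
    also have "\<dots> = K * (K - 1) div 2"
      by (metis Sum_Ico_nat atLeast0LessThan diff_zero mult_0)
    finally show ?thesis .
  qed
  have "K + K * (K - 1) div 2 = K * (K + 1) div 2"
    by (cases K) (auto simp: algebra_simps)
  with * assms show ?thesis
    by (simp add: regression_def num_params_def length_concat comp_def)
qed

text \<open>Designs are probability mass functions whose support lies in a region of the cube.\<close>

definition design_on :: "real Matrix.vec set \<Rightarrow> real Matrix.vec pmf \<Rightarrow> bool" where
  "design_on X \<xi> \<longleftrightarrow> set_pmf \<xi> \<subseteq> X"

definition information_matrix :: "nat \<Rightarrow> real Matrix.vec pmf \<Rightarrow> real Matrix.mat" where
  "information_matrix K \<xi> = Matrix.mat (num_params K) (num_params K)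
     (\<lambda>(i, j). \<Sum>x\<in>set_pmf \<xi>. pmf \<xi> x * (regression x $ i * regression x $ j))"

definition plus_count :: "real Matrix.vec \<Rightarrow> nat" where
  "plus_count x = card {i. i < dim_vec x \<and> x $ i = 1}"

definition region :: "nat \<Rightarrow> nat \<Rightarrow> nat \<Rightarrow> real Matrix.vec set" where
  "region K L U = {x \<in> cube K. L \<le> plus_count x \<and> plus_count x \<le> U}"

definition orbit :: "nat \<Rightarrow> nat \<Rightarrow> real Matrix.vec set" where
  "orbit K k = {x \<in> cube K. plus_count x = k}"

definition symmetric_orbit :: "nat \<Rightarrow> nat \<Rightarrow> real Matrix.vec set" where
  "symmetric_orbit K k = orbit K k \<union> orbit K (K - k)"

lemma finite_cube: "finite (cube K)"
proof (rule finite_subset)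
  show "cube K \<subseteq> vec_of_list ` {xs. set xs \<subseteq> {-1, 1} \<and> length xs = K}"
  proof
    fix x :: "real Matrix.vec" assume x: "x \<in> cube K"
    have "set (list_of_vec x) \<subseteq> {-1, 1}" "length (list_of_vec x) = K"
      using x by (auto simp: cube_def in_set_conv_nth list_of_vec_index)
    moreover have "x = vec_of_list (list_of_vec x)"
      by (simp add: vec_list)
    ultimately show "x \<in> vec_of_list ` {xs. set xs \<subseteq> {-1, 1} \<and> length xs = K}"
      by blast
  qed
  show "finite (vec_of_list ` {xs::real list. set xs \<subseteq> {-1, 1} \<and> length xs = K})"
    by (intro finite_imageI finite_lists_length_eq) simp
qed

lemma finite_orbit: "finite (orbit K k)"
  by (rule finite_subset[OF _ finite_cube]) (auto simp: orbit_def)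

lemma orbit_nonempty:
  assumes "k \<le> K"
  shows "orbit K k \<noteq> {}"
proof -
  let ?x = "Matrix.vec K (\<lambda>i. if i < k then 1 else - 1 :: real)"
  have "{i. i < dim_vec ?x \<and> ?x $ i = 1} = {..<k}"
    using assms by (auto split: if_splits)
  then have "?x \<in> orbit K k"
    by (simp add: orbit_def cube_def plus_count_def)
  then show ?thesis by blast
qed

text \<open>The two lemmas above make \<open>pmf_of_set\<close> the uniform distribution on \<open>orbit K k\<close> for
  \<open>k \<le> K\<close>.\<close>

definition uniform_design :: "nat \<Rightarrow> nat \<Rightarrow> real Matrix.vec pmf" where
  "uniform_design K k = pmf_of_set (orbit K k)"

text \<open>\<open>\<xi>\<close> is the symmetric invariant design with orbit weights \<open>w 0, \<dots>, w K\<close>; values of \<open>w\<close>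
  beyond \<open>K\<close> play no role.\<close>

definition symmetric_invariant_design ::
    "nat \<Rightarrow> (nat \<Rightarrow> real) \<Rightarrow> real Matrix.vec pmf \<Rightarrow> bool" where
  "symmetric_invariant_design K w \<xi> \<longleftrightarrow>
     (\<forall>k\<le>K. 0 \<le> w k) \<and> (\<Sum>k\<le>K. w k) = 1 \<and> (\<forall>k\<le>K. w k = w (K - k)) \<and>
     (\<forall>x. pmf \<xi> x = (\<Sum>k\<le>K. w k * pmf (uniform_design K k) x))"

definition supporting_orbits :: "nat \<Rightarrow> (nat \<Rightarrow> real) \<Rightarrow> real Matrix.vec set set" where
  "supporting_orbits K w = {symmetric_orbit K k |k. 2 * k \<le> K \<and> w k > 0}"

definition bound :: "nat \<Rightarrow> real" where
  "bound K = (if even K then (real K - sqrt (3 * real K - 2)) / 2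
              else (real K - sqrt (3 * real K)) / 2)"

end

theory Submission imports Defs begin

text \<open>Put \<open>S x = (\<Sum>i<K. x $ i)\<close>. For a permutation invariant weight on the cube the moments
  \<open>E[S^n * (\<Prod>i\<in>A. x $ i)]\<close> depend on \<open>A\<close> only through \<open>a = card A\<close>; as \<open>x $ i\<close> squares to
  \<open>1\<close>, they satisfy \<open>M(a, n + 1) = a * M(a - 1, n) + (K - a) * M(a + 1, n)\<close>. Hence the information
  matrix is the identity as soon as \<open>S\<close> has the first four moments \<open>0, K, 0, 3K\<^sup>2 - 2K\<close>.
  The odd ones vanish by symmetry. The even ones ask for a distribution of \<open>t = S\<^sup>2\<close> with mean \<open>K\<close>
  and second moment \<open>3K\<^sup>2 - 2K\<close>, and it is found on three points: the least possible value
  (\<open>0\<close> or \<open>1\<close>), the greatest one \<open>(K - 2L)\<^sup>2\<close>, and the least admissible square \<open>c \<ge> K\<close>. The bound on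
  \<open>L\<close> says exactly that the chord of \<open>t\<^sup>2\<close> between the extreme values lies above the required point.\<close>

section \<open>Moments of permutation invariant weights\<close>

definition entry_sum :: "real Matrix.vec \<Rightarrow> real" where
  "entry_sum x = (\<Sum>i<dim_vec x. x $ i)"

text \<open>The power of \<open>entry_sum\<close> and the monomial are kept together because
  multiplying by \<open>entry_sum\<close> turns a monomial into a sum of monomials, which yields a
  recurrence in \<open>n\<close>.\<close>

definition moment :: "nat \<Rightarrow> (real Matrix.vec \<Rightarrow> real) \<Rightarrow> nat \<Rightarrow> nat set \<Rightarrow> real" where
  "moment K h n A = (\<Sum>x\<in>cube K. h x * entry_sum x ^ n * (\<Prod>i\<in>A. x $ i))"

lemma cube_entry_sq: "x \<in> cube K \<Longrightarrow> i < K \<Longrightarrow> x $ i * x $ i = 1"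
  by (auto simp: cube_def)

lemma dim_vec_cube: "x \<in> cube K \<Longrightarrow> dim_vec x = K"
  by (auto simp: cube_def)

lemma plus_count_le: "x \<in> cube K \<Longrightarrow> plus_count x \<le> K"
  unfolding plus_count_def by (subst dim_vec_cube, assumption, rule order_trans[OF card_mono[of "{..<K}"]]) auto

lemma entry_sum_eq_plus_count:
  assumes "x \<in> cube K"
  shows "entry_sum x = 2 * real (plus_count x) - real K"
proof -
  have "entry_sum x = (\<Sum>i<K. 2 * (if x $ i = 1 then 1 else 0) - 1)"
    unfolding entry_sum_def dim_vec_cube[OF assms]
    using assms by (intro sum.cong) (auto simp: cube_def)
  also have "\<dots> = 2 * real (card {i. i < K \<and> x $ i = 1}) - real K"
    by (simp add: sum_subtractf flip: sum_distrib_left sum.inter_filter)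
  finally show ?thesis by (simp add: plus_count_def dim_vec_cube[OF assms])
qed

lemma entry_permutation:
  assumes \<pi>: "bij_betw \<pi> {..<K} {..<K}"
  defines "T \<equiv> \<lambda>x. Matrix.vec K (\<lambda>i. x $ \<pi> i :: real)"
  shows "bij_betw T (cube K) (cube K)"
    and "x \<in> cube K \<Longrightarrow> plus_count (T x) = plus_count x"
proof -
  have \<pi>_less: "\<pi> i < K" if "i < K" for i
    using \<pi> that by (auto dest: bij_betwE)
  have T_cube: "T x \<in> cube K" if "x \<in> cube K" for x
    using that \<pi>_less by (auto simp: cube_def T_def)
  have "inj_on T (cube K)"
  proof
    fix x y assume xy: "x \<in> cube K" "y \<in> cube K" "T x = T y"
    show "x = y"
    proof (rule eq_vecI)
      fix j assume "j < dim_vec y"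
      then obtain i where i: "i < K" "j = \<pi> i"
        using \<pi> xy(2) by (auto simp: dim_vec_cube bij_betw_def)
      have "T x $ i = T y $ i" using xy(3) by simp
      then show "x $ j = y $ j" using i by (simp add: T_def)
    qed (use xy in \<open>simp add: dim_vec_cube\<close>)
  qed
  then show "bij_betw T (cube K) (cube K)"
    using T_cube endo_inj_surj[OF finite_cube] by (auto simp: bij_betw_def image_subset_iff)
  assume x: "x \<in> cube K"
  have "bij_betw \<pi> {i. i < K \<and> x $ \<pi> i = 1} {i. i < K \<and> x $ i = 1}"
    using \<pi> by (rule bij_betw_subset) (use \<pi> \<pi>_less in \<open>auto simp: bij_betw_def\<close>)
  then show "plus_count (T x) = plus_count x"
    by (auto simp: plus_count_def T_def dim_vec_cube[OF x] dest: bij_betw_same_card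
        cong: conj_cong)
qed

text \<open>A bijection from \<open>A\<close> to \<open>B\<close> is glued to one between the
  complements, which have equal size because \<open>S\<close> is finite.\<close>

lemma exchanging_bijection:
  assumes "A \<subseteq> S" "B \<subseteq> S" "finite S" "card A = card B"
  obtains \<pi> where "bij_betw \<pi> S S" "bij_betw \<pi> A B"
proof -
  have fin: "finite A" "finite B" using assms finite_subset by auto
  obtain f where f: "bij_betw f A B"
    using finite_same_card_bij[OF fin assms(4)] by auto
  have "card (S - A) = card (S - B)"
    using assms fin by (simp add: card_Diff_subset)
  then obtain g where g: "bij_betw g (S - A) (S - B)"
    using finite_same_card_bij[of "S - A" "S - B"] assms(3) by auto
  define \<pi> where "\<pi> i = (if i \<in> A then f i else g i)" for i
  have 1: "bij_betw \<pi> A B"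
    using f by (subst bij_betw_cong[of _ _ f]) (auto simp: \<pi>_def)
  have 2: "bij_betw \<pi> (S - A) (S - B)"
    using g by (subst bij_betw_cong[of _ _ g]) (auto simp: \<pi>_def)
  have "bij_betw \<pi> (A \<union> (S - A)) (B \<union> (S - B))"
    by (rule bij_betw_combine[OF 1 2]) auto
  moreover have "A \<union> (S - A) = S" "B \<union> (S - B) = S" using assms by auto
  ultimately show thesis using that 1 by simp
qed

text \<open>Permuting the coordinates of \<open>x\<close> preserves \<open>plus_count\<close>, hence
  also \<open>h\<close> and \<open>entry_sum\<close>, while a permutation carrying \<open>A\<close>
  to \<open>B\<close> turns one monomial into the other.\<close>

lemma moment_cong_card:
  assumes h: "\<And>x. x \<in> cube K \<Longrightarrow> h x = g (plus_count x)"
    and A: "A \<subseteq> {..<K}" "B \<subseteq> {..<K}" "card A = card B"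
  shows "moment K h n A = moment K h n B"
proof -
  obtain \<pi> where \<pi>: "bij_betw \<pi> {..<K} {..<K}" "bij_betw \<pi> A B"
    using exchanging_bijection[OF A(1,2) _ A(3)] by auto
  define T where "T x = Matrix.vec K (\<lambda>i. x $ \<pi> i :: real)" for x
  note T = entry_permutation[OF \<pi>(1), folded T_def]
  have "moment K h n A
      = (\<Sum>x\<in>cube K. h (T x) * entry_sum (T x) ^ n * (\<Prod>i\<in>A. T x $ i))"
    unfolding moment_def by (rule sum.reindex_bij_betw[OF T(1), symmetric])
  also have "\<dots> = moment K h n B"
    unfolding moment_def
  proof (rule sum.cong)
    fix x assume x: "x \<in> cube K"
    then have Tx: "T x \<in> cube K" using T(1) by (auto dest: bij_betwE)
    have "(\<Prod>i\<in>A. T x $ i) = (\<Prod>i\<in>A. x $ \<pi> i)"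
      using A(1) by (intro prod.cong) (auto simp: T_def)
    also have "\<dots> = (\<Prod>i\<in>B. x $ i)"
      by (rule prod.reindex_bij_betw[OF \<pi>(2)])
    finally show "h (T x) * entry_sum (T x) ^ n * (\<Prod>i\<in>A. T x $ i)
        = h x * entry_sum x ^ n * (\<Prod>i\<in>B. x $ i)"
      using x Tx T(2) by (simp add: h entry_sum_eq_plus_count)
  qed simp
  finally show ?thesis .
qed

text \<open>Multiplying the monomial of \<open>A\<close> by \<open>x $ i\<close> cancels the factor
  \<open>i\<close> if \<open>i\<close> lies in \<open>A\<close>, since \<open>x $ i\<close> squares
  to 1, and adjoins it otherwise.\<close>

lemma moment_Suc:
  assumes A: "A \<subseteq> {..<K}"
  shows "moment K h (Suc n) A
    = (\<Sum>i\<in>A. moment K h n (A - {i})) + (\<Sum>i\<in>{..<K} - A. moment K h n (insert i A))"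
proof -
  have fin: "finite A" using A finite_subset by auto
  have *: "entry_sum x * (\<Prod>j\<in>A. x $ j)
      = (\<Sum>i\<in>A. \<Prod>j\<in>A - {i}. x $ j) + (\<Sum>i\<in>{..<K} - A. \<Prod>j\<in>insert i A. x $ j)"
    if x: "x \<in> cube K" for x
  proof -
    have "entry_sum x * (\<Prod>j\<in>A. x $ j) = (\<Sum>i<K. x $ i * (\<Prod>j\<in>A. x $ j))"
      by (simp add: entry_sum_def dim_vec_cube[OF x] sum_distrib_right)
    also have "\<dots> = (\<Sum>i\<in>{..<K} - A. x $ i * (\<Prod>j\<in>A. x $ j)) + (\<Sum>i\<in>A. x $ i * (\<Prod>j\<in>A. x $ j))"
      by (rule sum.subset_diff[OF A]) simp
    also have "(\<Sum>i\<in>A. x $ i * (\<Prod>j\<in>A. x $ j)) = (\<Sum>i\<in>A. \<Prod>j\<in>A - {i}. x $ j)"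
    proof (rule sum.cong)
      fix i assume i: "i \<in> A"
      have "x $ i * (\<Prod>j\<in>A. x $ j) = (x $ i * x $ i) * (\<Prod>j\<in>A - {i}. x $ j)"
        using fin i by (simp add: prod.remove mult.assoc)
      then show "x $ i * (\<Prod>j\<in>A. x $ j) = (\<Prod>j\<in>A - {i}. x $ j)"
        using cube_entry_sq[OF x, of i] i A by auto
    qed simp
    also have "(\<Sum>i\<in>{..<K} - A. x $ i * (\<Prod>j\<in>A. x $ j)) = (\<Sum>i\<in>{..<K} - A. \<Prod>j\<in>insert i A. x $ j)"
      using fin by (intro sum.cong) auto
    finally show ?thesis by simp
  qed
  have "moment K h (Suc n) A = (\<Sum>x\<in>cube K. h x * entry_sum x ^ n * (entry_sum x * (\<Prod>j\<in>A. x $ j)))"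
    unfolding moment_def by (simp add: mult_ac)
  also have "\<dots> = (\<Sum>x\<in>cube K. (\<Sum>i\<in>A. h x * entry_sum x ^ n * (\<Prod>j\<in>A - {i}. x $ j))
      + (\<Sum>i\<in>{..<K} - A. h x * entry_sum x ^ n * (\<Prod>j\<in>insert i A. x $ j)))"
    by (intro sum.cong refl) (simp only: * distrib_left sum_distrib_left)
  also have "\<dots> = (\<Sum>i\<in>A. moment K h n (A - {i})) + (\<Sum>i\<in>{..<K} - A. moment K h n (insert i A))"
    unfolding moment_def sum.distrib by (intro arg_cong2[where f = "(+)"] sum.swap)
  finally show ?thesis .
qed

text \<open>Initial segments represent the index sets of each size. At the ends \<open>a = 0\<close>
  and \<open>a = K\<close> the coefficients \<open>real a\<close> and \<open>real (K - a)\<close>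
  vanish, so the truncated \<open>a - 1\<close> and the set \<open>{..<Suc K}\<close> are
  harmless.\<close>

lemma moment_recurrence:
  assumes h: "\<And>x. x \<in> cube K \<Longrightarrow> h x = g (plus_count x)" and a: "a \<le> K"
  shows "moment K h (Suc n) {..<a}
    = real a * moment K h n {..<a - 1} + real (K - a) * moment K h n {..<Suc a}"
proof -
  have "moment K h n ({..<a} - {i}) = moment K h n {..<a - 1}" if "i < a" for i
    by (rule moment_cong_card[where h = h and g = g, OF h]) (use a that in auto)
  moreover have "moment K h n (insert i {..<a}) = moment K h n {..<Suc a}" if "i \<in> {..<K} - {..<a}" for i
    by (rule moment_cong_card[where h = h and g = g, OF h]) (use a that in auto)
  ultimately show ?thesis
    using a by (subst moment_Suc) (simp_all add: card_Diff_subset)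
qed

text \<open>The recurrence is solved for \<open>M a 0\<close>, starting from \<open>M 0 a\<close>;
  the unknown appears with coefficient K(K-1)...(K-a+1), which is nonzero for \<open>a\<close> at
  most \<open>K\<close>. The prescribed values are the moments of a sum of \<open>K\<close>
  independent fair signs.\<close>

lemma product_moments_vanish:
  assumes h: "\<And>x. x \<in> cube K \<Longrightarrow> h x = g (plus_count x)"
    and m0: "moment K h 0 {} = 1" and m1: "moment K h 1 {} = 0"
    and m2: "moment K h 2 {} = real K" and m3: "moment K h 3 {} = 0"
    and m4: "moment K h 4 {} = 3 * (real K)\<^sup>2 - 2 * real K"
    and A: "A \<subseteq> {..<K}" "A \<noteq> {}" "card A \<le> 4"
  shows "moment K h 0 A = 0"
proof -
  define M where "M a n = moment K h n {..<a}" for a n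
  have rec: "M a (Suc n) = real a * M (a - 1) n + real (K - a) * M (Suc a) n" if "a \<le> K" for a n
    using moment_recurrence[where h = h and g = g, OF h that] by (simp add: M_def)
  have M0: "M 0 0 = 1" "M 0 1 = 0" "M 0 2 = real K" "M 0 3 = 0" "M 0 4 = 3 * (real K)\<^sup>2 - 2 * real K"
    using m0 m1 m2 m3 m4 by (simp_all add: M_def)
  have "finite A" using A(1) finite_subset by blast
  then have cA: "card A \<noteq> 0" "card A \<le> K"
    using A(1,2) card_mono[of "{..<K}" A] by auto
  have K1: "K \<ge> 1" using cA by simp
  have M10: "M 1 0 = 0"
    using rec[of 0 0] M0 K1 by simp
  have M20: "M 2 0 = 0" if "K \<ge> 2"
    using rec[of 0 1] rec[of 1 0] M0 that by (simp add: numeral_2_eq_2)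
  have M30: "M 3 0 = 0" if "K \<ge> 3"
    using rec[of 0 2] rec[of 1 1] rec[of 2 0] M0 M10 that
    by (simp add: eval_nat_numeral)
  have M40: "M 4 0 = 0" if K: "K \<ge> 4"
  proof -
    have "M 1 1 = 1" using rec[of 1 0] M0 M20 K by (simp add: numeral_2_eq_2)
    moreover have "M 3 1 = (real K - 3) * M 4 0"
      using rec[of 3 0] M20 K by (simp add: eval_nat_numeral)
    ultimately have "M 2 2 = 2 + (real K - 2) * ((real K - 3) * M 4 0)"
      using rec[of 2 1] K by (simp add: eval_nat_numeral)
    then have "M 1 3 = real K + (real K - 1) * (2 + (real K - 2) * ((real K - 3) * M 4 0))"
      using rec[of 1 2] M0 K by (simp add: eval_nat_numeral)
    then have "M 0 4 = real K * (real K + (real K - 1) * (2 + (real K - 2) * ((real K - 3) * M 4 0)))"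
      using rec[of 0 3] by (simp add: eval_nat_numeral)
    \<comment> \<open>The terms without \<open>M 4 0\<close> add up to K(K + 2(K-1)), which is
      exactly the prescribed fourth moment.\<close>
    then have "real K * ((real K - 1) * ((real K - 2) * ((real K - 3) * M 4 0))) = 0"
      using M0(5) by (simp add: algebra_simps power2_eq_square)
    then show ?thesis using K by auto
  qed
  have "moment K h 0 A = M (card A) 0"
    unfolding M_def by (rule moment_cong_card[where h = h and g = g, OF h]) (use A cA in auto)
  also have "card A = 1 \<or> card A = 2 \<or> card A = 3 \<or> card A = 4"
    using cA A(3) by auto
  then have "M (card A) 0 = 0"
    using M10 M20 M30 M40 cA(2) by auto
  finally show ?thesis .
qed

section \<open>The information matrix\<close>

text \<open>The index sets of the monomials in \<open>regression\<close>, listed in the same order,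
  so that positions in the two lists correspond.\<close>

definition factor_sets :: "nat \<Rightarrow> nat set list" where
  "factor_sets K = {} # map (\<lambda>i. {i}) [0..<K] @ [{i, j}. i \<leftarrow> [0..<K], j \<leftarrow> [Suc i..<K]]"

lemma regression_eq_factor_sets:
  assumes "x \<in> cube K"
  shows "regression x = vec_of_list (map (\<lambda>A. \<Prod>t\<in>A. x $ t) (factor_sets K))"
proof -
  have "list_of_vec x = map (($) x) [0..<K]"
    using dim_vec_cube[OF assms] by (intro nth_equalityI) (auto simp: list_of_vec_index)
  then show ?thesis
    unfolding regression_def factor_sets_def dim_vec_cube[OF assms]
    by (auto simp: map_concat comp_def intro!: arg_cong[where f = vec_of_list] arg_cong[where f = concat])
qed

lemma distinct_concat_map:
  assumes "distinct xs" "\<And>x. x \<in> set xs \<Longrightarrow> distinct (f x)"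
    "\<And>x y. x \<in> set xs \<Longrightarrow> y \<in> set xs \<Longrightarrow> x \<noteq> y \<Longrightarrow> set (f x) \<inter> set (f y) = {}"
  shows "distinct (concat (map f xs))"
  using assms
proof (induction xs)
  case (Cons x xs)
  have "distinct (concat (map f xs))"
    using Cons.prems by (intro Cons.IH) auto
  moreover have "set (f x) \<inter> set (f y) = {}" if "y \<in> set xs" for y
    using Cons.prems that by (intro Cons.prems(3)) auto
  ultimately show ?case using Cons.prems(2) by auto
qed simp

text \<open>Needed off the diagonal: different positions then have a nonempty symmetric
  difference.\<close>

lemma distinct_factor_sets: "distinct (factor_sets K)"
proof -
  have "distinct [{i, j}. i \<leftarrow> [0..<K], j \<leftarrow> [Suc i..<K]]"
    by (rule distinct_concat_map) (auto simp: distinct_map inj_on_def doubleton_eq_iff)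
  moreover have "distinct (map (\<lambda>i. {i}) [0..<K])"
    by (simp add: distinct_map)
  moreover have "{} \<notin> set (map (\<lambda>i. {i}) [0..<K] @ [{i, j}. i \<leftarrow> [0..<K], j \<leftarrow> [Suc i..<K]])"
    by auto
  moreover have "set (map (\<lambda>i. {i}) [0..<K]) \<inter> set [{i, j}. i \<leftarrow> [0..<K], j \<leftarrow> [Suc i..<K]] = {}"
  proof (rule ccontr)
    assume "\<not> ?thesis"
    then obtain A where A: "A \<in> set (map (\<lambda>i. {i}) [0..<K])"
      "A \<in> set [{i, j}. i \<leftarrow> [0..<K], j \<leftarrow> [Suc i..<K]]" by blast
    obtain a where "A = {a}" using A(1) by auto
    moreover obtain i j where "A = {i, j}" "i < j" using A(2) by (auto simp: Suc_le_eq)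
    ultimately show False by (metis insertCI less_irrefl singletonD)
  qed
  ultimately show ?thesis
    unfolding factor_sets_def distinct.simps(2) distinct_append by blast
qed

lemma factor_sets_bounds:
  "A \<in> set (factor_sets K) \<Longrightarrow> A \<subseteq> {..<K} \<and> card A \<le> 2"
  by (auto simp: factor_sets_def card_insert_if)

text \<open>Evaluating \<open>regression\<close> at any one point of the cube transfers the count
  from \<open>dim_regression\<close>.\<close>

lemma length_factor_sets: "length (factor_sets K) = num_params K"
proof -
  obtain x where x: "x \<in> orbit K 0" using orbit_nonempty[of 0 K] by auto
  then have c: "x \<in> cube K" by (simp add: orbit_def)
  then have "dim_vec (regression x) = num_params K"
    by (intro dim_regression) (simp add: cube_def)
  then show ?thesis by (simp add: regression_eq_factor_sets[OF c])
qed

text \<open>Each common index contributes a square, which is 1 on the cube.\<close>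

lemma prod_mult_sym_diff:
  assumes "x \<in> cube K" "A \<subseteq> {..<K}" "B \<subseteq> {..<K}"
  shows "(\<Prod>t\<in>A. x $ t) * (\<Prod>t\<in>B. x $ t) = (\<Prod>t\<in>sym_diff A B. x $ t)"
proof -
  have fin: "finite A" "finite B" using assms finite_subset by auto
  have A: "(\<Prod>t\<in>A. x $ t) = (\<Prod>t\<in>A - B. x $ t) * (\<Prod>t\<in>A \<inter> B. x $ t)"
    using fin by (subst prod.union_disjoint[symmetric]) (auto intro: prod.cong)
  have B: "(\<Prod>t\<in>B. x $ t) = (\<Prod>t\<in>B - A. x $ t) * (\<Prod>t\<in>A \<inter> B. x $ t)"
    using fin by (subst prod.union_disjoint[symmetric]) (auto intro: prod.cong)
  have D: "(\<Prod>t\<in>sym_diff A B. x $ t) = (\<Prod>t\<in>A - B. x $ t) * (\<Prod>t\<in>B - A. x $ t)"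
    using fin by (subst prod.union_disjoint[symmetric]) (auto intro: prod.cong)
  have "(\<Prod>t\<in>A \<inter> B. x $ t) * (\<Prod>t\<in>A \<inter> B. x $ t) = (\<Prod>t\<in>A \<inter> B. x $ t * x $ t)"
    by (simp add: prod.distrib)
  also have "\<dots> = 1"
    using assms by (intro prod.neutral) (auto simp: cube_entry_sq)
  finally have *: "(\<Prod>t\<in>A \<inter> B. x $ t) * (\<Prod>t\<in>A \<inter> B. x $ t) = 1" .
  have "(\<Prod>t\<in>A. x $ t) * (\<Prod>t\<in>B. x $ t) = (\<Prod>t\<in>sym_diff A B. x $ t)
      * ((\<Prod>t\<in>A \<inter> B. x $ t) * (\<Prod>t\<in>A \<inter> B. x $ t))"
    unfolding A B D by (simp only: mult_ac)
  then show ?thesis by (simp only: * mult_1_right)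
qed

text \<open>Each entry is the moment of a symmetric difference of two sets of size at most 2. On the
  diagonal this set is empty and the moment is the total mass; off the diagonal it has between 1 and
  4 elements and the moment vanishes. The function \<open>g\<close> expresses permutation
  invariance.\<close>

lemma information_matrix_eq_one:
  assumes supp: "set_pmf \<xi> \<subseteq> cube K"
    and h: "\<And>x. x \<in> cube K \<Longrightarrow> pmf \<xi> x = g (plus_count x)"
    and m: "moment K (pmf \<xi>) 0 {} = 1" "moment K (pmf \<xi>) 1 {} = 0"
      "moment K (pmf \<xi>) 2 {} = real K" "moment K (pmf \<xi>) 3 {} = 0"
      "moment K (pmf \<xi>) 4 {} = 3 * (real K)\<^sup>2 - 2 * real K"
  shows "information_matrix K \<xi> = 1\<^sub>m (num_params K)"
proof (rule eq_matI)
  fix i j assume "i < dim_row (1\<^sub>m (num_params K) :: real Matrix.mat)"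
    "j < dim_col (1\<^sub>m (num_params K) :: real Matrix.mat)"
  then have ij: "i < num_params K" "j < num_params K" by auto
  define A B where "A = factor_sets K ! i" and "B = factor_sets K ! j"
  have AB: "A \<in> set (factor_sets K)" "B \<in> set (factor_sets K)"
    using ij by (auto simp: A_def B_def length_factor_sets)
  note bnd = factor_sets_bounds[OF AB(1)] factor_sets_bounds[OF AB(2)]
  have reg: "regression x $ i = (\<Prod>t\<in>A. x $ t)" "regression x $ j = (\<Prod>t\<in>B. x $ t)"
    if "x \<in> cube K" for x
    using ij that by (auto simp: regression_eq_factor_sets A_def B_def length_factor_sets
        vec_of_list_index)
  have "information_matrix K \<xi> $$ (i, j)
      = (\<Sum>x\<in>set_pmf \<xi>. pmf \<xi> x * (regression x $ i * regression x $ j))"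
    using ij by (simp add: information_matrix_def)
  also have "\<dots> = (\<Sum>x\<in>cube K. pmf \<xi> x * (regression x $ i * regression x $ j))"
    by (rule sum.mono_neutral_left[OF finite_cube supp]) (auto simp: set_pmf_iff)
  also have "\<dots> = moment K (pmf \<xi>) 0 (sym_diff A B)"
    unfolding moment_def using bnd
    by (intro sum.cong) (auto simp: reg prod_mult_sym_diff)
  also have "\<dots> = (if i = j then 1 else 0)"
  proof (cases "i = j")
    case True
    then have "sym_diff A B = {}" by (simp add: A_def B_def)
    then show ?thesis using True m(1) by metis
  next
    case False
    then have "A \<noteq> B"
      using distinct_factor_sets[of K] ij by (auto simp: A_def B_def length_factor_sets nth_eq_iff_index_eq)
    then have "sym_diff A B \<noteq> {}" by auto
    moreover have "card (sym_diff A B) \<le> 4"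
    proof -
      have fin: "finite A" "finite B" using bnd finite_subset by blast+
      have "card (sym_diff A B) \<le> card (A \<union> B)"
        using fin by (intro card_mono) auto
      also have "\<dots> \<le> card A + card B" by (rule card_Un_le)
      finally show ?thesis using bnd by simp
    qed
    ultimately have "moment K (pmf \<xi>) 0 (sym_diff A B) = 0"
      using bnd by (intro product_moments_vanish[where h = "pmf \<xi>" and g = g, OF h m]) auto
    then show ?thesis using False by simp
  qed
  finally show "information_matrix K \<xi> $$ (i, j) = 1\<^sub>m (num_params K) $$ (i, j)"
    using ij by simp
qed (auto simp: information_matrix_def)

section \<open>Invariant designs\<close>

text \<open>The convex combination is nonnegative and has total mass 1 for counting measure, so
  \<open>embed_pmf\<close> realises it.\<close>

lemma mixture_pmf_exists:
  fixes w :: "'i \<Rightarrow> real" and p :: "'i \<Rightarrow> 'a pmf"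
  assumes "finite I" "\<And>k. k \<in> I \<Longrightarrow> 0 \<le> w k" "sum w I = 1"
  shows "\<exists>q. \<forall>x. pmf q x = (\<Sum>k\<in>I. w k * pmf (p k) x)"
proof -
  let ?f = "\<lambda>x. \<Sum>k\<in>I. w k * pmf (p k) x"
  have nonneg: "0 \<le> ?f x" for x
    using assms by (intro sum_nonneg mult_nonneg_nonneg) auto
  have "(\<integral>\<^sup>+x. ennreal (?f x) \<partial>count_space UNIV)
      = (\<integral>\<^sup>+x. (\<Sum>k\<in>I. ennreal (w k) * ennreal (pmf (p k) x)) \<partial>count_space UNIV)"
    using assms by (intro nn_integral_cong)
      (simp flip: sum_ennreal add: ennreal_mult)
  also have "\<dots> = (\<Sum>k\<in>I. ennreal (w k) * (\<integral>\<^sup>+x. ennreal (pmf (p k) x) \<partial>count_space UNIV))"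
    by (simp add: nn_integral_sum nn_integral_cmult)
  also have "\<dots> = (\<Sum>k\<in>I. ennreal (w k))"
    by (simp add: nn_integral_pmf)
  also have "\<dots> = 1"
    using assms by simp
  finally have "pmf (embed_pmf ?f) x = ?f x" for x
    using nonneg by (intro pmf_embed_pmf) auto
  then show ?thesis by blast
qed

lemma pmf_uniform_design:
  "k \<le> K \<Longrightarrow> pmf (uniform_design K k) x = (if x \<in> orbit K k then 1 / card (orbit K k) else 0)"
  by (simp add: uniform_design_def finite_orbit orbit_nonempty indicator_def)

text \<open>The orbits partition the cube, so a single summand survives. This exhibits the point
  mass as a function of \<open>plus_count\<close>, as the moment lemmas require.\<close>

lemma pmf_invariant_design:
  assumes "symmetric_invariant_design K w \<xi>" "x \<in> cube K"
  shows "pmf \<xi> x = w (plus_count x) / card (orbit K (plus_count x))"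
proof -
  have "pmf \<xi> x = (\<Sum>k\<le>K. w k * pmf (uniform_design K k) x)"
    using assms(1) unfolding symmetric_invariant_design_def by blast
  also have "\<dots> = (\<Sum>k\<le>K. if plus_count x = k then w k / card (orbit K k) else 0)"
    using assms(2) by (intro sum.cong) (auto simp: pmf_uniform_design orbit_def)
  also have "\<dots> = w (plus_count x) / card (orbit K (plus_count x))"
    using plus_count_le[OF assms(2)] by simp
  finally show ?thesis .
qed

lemma set_pmf_invariant_design:
  assumes "symmetric_invariant_design K w \<xi>" "x \<in> set_pmf \<xi>"
  shows "x \<in> cube K" "w (plus_count x) > 0"
proof -
  have "pmf \<xi> x \<noteq> 0" using assms(2) by (simp add: set_pmf_iff)
  moreover have "pmf \<xi> x = (\<Sum>k\<le>K. w k * pmf (uniform_design K k) x)"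
    using assms(1) unfolding symmetric_invariant_design_def by blast
  ultimately obtain k where k: "k \<le> K" "w k * pmf (uniform_design K k) x \<noteq> 0"
    using sum.not_neutral_contains_not_neutral[of "\<lambda>k. w k * pmf (uniform_design K k) x" "{..K}"]
    by auto
  then have x: "x \<in> orbit K k" and "w k \<noteq> 0"
    by (auto simp: pmf_uniform_design split: if_splits)
  moreover have "0 \<le> w k" using assms(1) k(1) unfolding symmetric_invariant_design_def by blast
  ultimately show "x \<in> cube K" "w (plus_count x) > 0"
    by (auto simp: orbit_def)
qed

text \<open>On the orbit with index \<open>k\<close> the sum of the entries is constantly 2k -
  K.\<close>

lemma moment_invariant_design:
  assumes "symmetric_invariant_design K w \<xi>"
  shows "moment K (pmf \<xi>) n {} = (\<Sum>k\<le>K. w k * (2 * real k - real K) ^ n)"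
proof -
  have "moment K (pmf \<xi>) n {}
      = (\<Sum>x\<in>cube K. \<Sum>k\<le>K. w k * (pmf (uniform_design K k) x * entry_sum x ^ n))"
  proof -
    have "pmf \<xi> x = (\<Sum>k\<le>K. w k * pmf (uniform_design K k) x)" for x
      using assms unfolding symmetric_invariant_design_def by blast
    then show ?thesis by (simp add: moment_def sum_distrib_right mult.assoc)
  qed
  also have "\<dots> = (\<Sum>k\<le>K. w k * (\<Sum>x\<in>cube K. pmf (uniform_design K k) x * entry_sum x ^ n))"
    by (subst sum.swap) (simp add: sum_distrib_left)
  also have "\<dots> = (\<Sum>k\<le>K. w k * (2 * real k - real K) ^ n)"
  proof (intro sum.cong refl)
    fix k assume "k \<in> {..K}"
    then have k: "k \<le> K" by simp
    have "(\<Sum>x\<in>cube K. pmf (uniform_design K k) x * entry_sum x ^ n)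
        = (\<Sum>x\<in>orbit K k. 1 / card (orbit K k) * (2 * real k - real K) ^ n)"
      using k by (intro sum.mono_neutral_cong_right finite_cube)
        (auto simp: pmf_uniform_design orbit_def entry_sum_eq_plus_count)
    also have "\<dots> = (2 * real k - real K) ^ n"
      using k orbit_nonempty[OF k] by (simp add: finite_orbit)
    finally show "w k * (\<Sum>x\<in>cube K. pmf (uniform_design K k) x * entry_sum x ^ n)
        = w k * (2 * real k - real K) ^ n" by simp
  qed
  finally show ?thesis .
qed

text \<open>The reflection of \<open>k\<close> to \<open>K - k\<close> preserves the weights and
  changes the sign of 2k - K.\<close>

lemma odd_moment_symmetric_design:
  assumes "symmetric_invariant_design K w \<xi>" "odd n"
  shows "moment K (pmf \<xi>) n {} = 0"
proof -
  let ?m = "\<Sum>k\<le>K. w k * (2 * real k - real K) ^ n"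
  have "?m = (\<Sum>k\<le>K. w (K - k) * (2 * real (K - k) - real K) ^ n)"
    by (rule sum.reindex_bij_witness[of _ "\<lambda>k. K - k" "\<lambda>k. K - k"]) auto
  also have "\<dots> = (\<Sum>k\<le>K. - (w k * (2 * real k - real K) ^ n))"
  proof (intro sum.cong refl)
    fix k assume "k \<in> {..K}"
    then have k: "k \<le> K" by simp
    then have "2 * real (K - k) - real K = - (2 * real k - real K)"
      by (simp)
    moreover have "w (K - k) = w k"
      using assms(1) k unfolding symmetric_invariant_design_def by metis
    ultimately show "w (K - k) * (2 * real (K - k) - real K) ^ n = - (w k * (2 * real k - real K) ^ n)"
      by (simp only: power_minus_odd[OF assms(2)] mult_minus_right)
  qed
  also have "\<dots> = - ?m" by (rule sum_negf)
  finally show ?thesis using moment_invariant_design[OF assms(1)] by simp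
qed

section \<open>Choice of the three orbits\<close>

text \<open>The weights are the expectations of the Lagrange basis polynomials at the nodes
  \<open>T\<close>, \<open>c\<close>, \<open>m\<close>, computed from mean \<open>\<mu>\<close> and
  second moment \<open>Q\<close>. The hypotheses \<open>low\<close> and \<open>up\<close> are the
  signs of \<open>p\<close> and \<open>q\<close>; that of \<open>r\<close> follows from the variance
  being nonnegative.\<close>

lemma three_point_weights:
  fixes m c T \<mu> Q :: real
  assumes "m < c" "c \<le> T" "m \<le> \<mu>" "\<mu> \<le> c" "\<mu>\<^sup>2 \<le> Q"
    and up: "Q \<le> (m + T) * \<mu> - m * T" and low: "(m + c) * \<mu> - m * c \<le> Q"
  shows "\<exists>p q r. 0 \<le> p \<and> 0 \<le> q \<and> 0 \<le> r \<and> p + q + r = 1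
    \<and> p * T + q * c + r * m = \<mu> \<and> p * T\<^sup>2 + q * c\<^sup>2 + r * m\<^sup>2 = Q"
proof (cases "c = T")
  case True
  \<comment> \<open>With \<open>c = T\<close> the two chord bounds coincide and determine
    \<open>Q\<close>, so the two-point distribution on \<open>m\<close> and \<open>T\<close> with
    mean \<open>\<mu>\<close> works.\<close>
  then have Q: "Q = (m + T) * \<mu> - m * T" using up low by simp
  define D where "D = T - m"
  have D: "D > 0" using assms by (simp add: D_def)
  have "(\<mu> - m) / D * T + (T - \<mu>) / D * m = \<mu>"
    using D by (simp add: field_simps) (simp add: D_def algebra_simps)
  moreover have "(\<mu> - m) / D * T\<^sup>2 + (T - \<mu>) / D * m\<^sup>2 = Q"
    unfolding Q using D by (simp add: field_simps) (simp add: D_def algebra_simps power2_eq_square)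
  moreover have "(\<mu> - m) / D + (T - \<mu>) / D = 1"
    using D by (simp add: field_simps) (simp add: D_def algebra_simps)
  ultimately show ?thesis
    using assms D True
    by (intro exI[of _ "(\<mu> - m) / D"] exI[of _ 0] exI[of _ "(T - \<mu>) / D"]) auto
next
  case False
  then have d: "T - c > 0" "c - m > 0" "T - m > 0" using assms by auto
  define p where "p = (Q - (m + c) * \<mu> + m * c) / ((T - m) * (T - c))"
  define q where "q = ((m + T) * \<mu> - m * T - Q) / ((c - m) * (T - c))"
  define r where "r = (Q - (c + T) * \<mu> + c * T) / ((c - m) * (T - m))"
  \<comment> \<open>The expectation of (t - c)(t - T) is its value at the mean plus the
    variance.\<close>
  have "Q - (c + T) * \<mu> + c * T = (c - \<mu>) * (T - \<mu>) + (Q - \<mu>\<^sup>2)"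
    by (simp add: algebra_simps power2_eq_square)
  also have "\<dots> \<ge> 0" using assms by simp
  finally have "r \<ge> 0" using d by (simp add: r_def)
  moreover have "p \<ge> 0" "q \<ge> 0" using d up low by (simp_all add: p_def q_def)
  moreover define D where "D = (T - c) * (c - m) * (T - m)"
  have D: "D \<noteq> 0" using d by (simp add: D_def)
  \<comment> \<open>Over the common denominator \<open>D\<close> the three moment equations become
    polynomial identities.\<close>
  have pqr: "p = (Q - (m + c) * \<mu> + m * c) * (c - m) / D"
    "q = ((m + T) * \<mu> - m * T - Q) * (T - m) / D"
    "r = (Q - (c + T) * \<mu> + c * T) * (T - c) / D"
    using d by (simp_all add: p_def q_def r_def D_def)
  have "p + q + r = 1"
    unfolding pqr using D by (simp add: field_simps) (simp add: D_def algebra_simps)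
  moreover have "p * T + q * c + r * m = \<mu>"
    unfolding pqr using D by (simp add: field_simps) (simp add: D_def algebra_simps)
  moreover have "p * T\<^sup>2 + q * c\<^sup>2 + r * m\<^sup>2 = Q"
  proof -
    have "(Q - (m + c) * \<mu> + m * c) * (c - m) * T\<^sup>2 + ((m + T) * \<mu> - m * T - Q) * (T - m) * c\<^sup>2
        + (Q - (c + T) * \<mu> + c * T) * (T - c) * m\<^sup>2 = Q * D"
      by (simp add: D_def algebra_simps power2_eq_square)
    then have "((Q - (m + c) * \<mu> + m * c) * (c - m) * T\<^sup>2 + ((m + T) * \<mu> - m * T - Q) * (T - m) * c\<^sup>2
        + (Q - (c + T) * \<mu> + c * T) * (T - c) * m\<^sup>2) / D = Q"
      using D by simp
    then show ?thesis
      unfolding pqr by (simp only: add_divide_distrib times_divide_eq_left)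
  qed
  ultimately show ?thesis by blast
qed

text \<open>\<open>r\<close> is the largest number of the parity of \<open>K\<close> whose square is less than \<open>K\<close>, and
  \<open>r + 2\<close> is the required root. By parity \<open>r\<^sup>2 \<le> K - 2\<close>, and \<open>4 * r + 4 \<le> 2 * K\<close> (up to the parity
  correction) follows from \<open>(r - 1)\<^sup>2 \<ge> 0\<close>.\<close>

lemma middle_square_exists:
  fixes K :: nat
  assumes "K \<ge> 2"
  shows "\<exists>s. even (K + s) \<and> K \<le> s\<^sup>2 \<and> s\<^sup>2 + (if even K then 2 else 0) \<le> 3 * K"
proof -
  define P where "P r \<longleftrightarrow> even (K + r) \<and> r\<^sup>2 < K" for r
  have "P (K mod 2)" using assms by (auto simp: P_def mod2_eq_if)
  moreover have bnd: "r \<le> K" if "P r" for r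
    using that self_le_power[of r 2] by (cases "r = 0") (auto simp: P_def)
  ultimately obtain r where r: "P r" and max: "\<And>r'. P r' \<Longrightarrow> r' \<le> r"
    using GreatestI_nat[of P "K mod 2" K] Greatest_le_nat[of P _ K] by metis
  have "\<not> P (r + 2)" using max[of "r + 2"] by auto
  then have ge: "K \<le> (r + 2)\<^sup>2" using r by (auto simp: P_def)
  have par: "even (K + r\<^sup>2)" "even (K + r)" "r\<^sup>2 < K" using r by (auto simp: P_def)
  then have "r\<^sup>2 + 2 \<le> K" by presburger
  moreover have "2 * int r \<le> int r ^ 2 + 1"
    using zero_le_power2[of "int r - 1"] by (simp add: power2_diff)
  then have "2 * r \<le> r\<^sup>2 + 1" by (simp flip: of_nat_power)
  ultimately have "2 * r + 1 \<le> K" "even K \<Longrightarrow> 2 * r + 2 \<le> K"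
    by presburger+
  moreover have "(r + 2)\<^sup>2 = r\<^sup>2 + 4 * r + 4"
    by (simp add: power2_eq_square algebra_simps)
  ultimately have "(r + 2)\<^sup>2 + (if even K then 2 else 0) \<le> 3 * K"
    using \<open>r\<^sup>2 + 2 \<le> K\<close> by (simp only:) auto
  then show ?thesis using ge par by (intro exI[of _ "r + 2"]) auto
qed

text \<open>Squaring \<open>sqrt R \<le> K - 2 * L\<close> is legitimate because the right side is
  nonnegative, which also makes the natural subtraction exact. The parity term matches the one in
  \<open>middle_square_exists\<close>, so the two inequalities chain.\<close>

lemma bound_square:
  assumes "K \<ge> 2" "real L \<le> bound K"
  shows "2 * L \<le> K" "3 * K \<le> (K - 2 * L)\<^sup>2 + (if even K then 2 else 0)"
proof -
  define R where "R = (if even K then 3 * real K - 2 else 3 * real K)"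
  have R: "R \<ge> 0" using assms by (simp add: R_def)
  have "sqrt R \<le> real K - 2 * real L"
    using assms(2) by (auto simp: bound_def R_def field_simps split: if_splits)
  moreover from this have nonneg: "real K - 2 * real L \<ge> 0"
    using R by (meson order_trans real_sqrt_ge_zero)
  ultimately have "R \<le> (real K - 2 * real L)\<^sup>2"
    using R by (metis power_mono real_sqrt_ge_zero real_sqrt_pow2)
  moreover show le: "2 * L \<le> K" using nonneg by linarith
  ultimately have "R \<le> real ((K - 2 * L)\<^sup>2)" by (simp)
  then have "real (3 * K) \<le> real ((K - 2 * L)\<^sup>2 + (if even K then 2 else 0))"
    by (simp add: R_def split: if_splits)
  then show "3 * K \<le> (K - 2 * L)\<^sup>2 + (if even K then 2 else 0)"
    by (simp only: of_nat_le_iff)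
qed

text \<open>The weights are obtained by reflecting a weight \<open>v\<close> on \<open>{L, b, K div 2}\<close>; the orbit index \<open>k\<close>
  corresponds to \<open>t = (K - 2k)\<^sup>2\<close>.\<close>

lemma symmetric_weights_exist:
  assumes "K \<ge> 2" "real L \<le> bound K"
  obtains w b where "\<And>k. k \<le> K \<Longrightarrow> 0 \<le> w k" "(\<Sum>k\<le>K. w k) = 1"
    "\<And>k. k \<le> K \<Longrightarrow> w k = w (K - k)"
    "(\<Sum>k\<le>K. w k * (2 * real k - real K)\<^sup>2) = real K"
    "(\<Sum>k\<le>K. w k * (2 * real k - real K) ^ 4) = 3 * (real K)\<^sup>2 - 2 * real K"
    "\<And>k. k \<le> K \<Longrightarrow> w k > 0 \<Longrightarrow> L \<le> k \<and> k \<le> K - L"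
    "\<And>k. 2 * k \<le> K \<Longrightarrow> w k > 0 \<Longrightarrow> k \<in> {L, b, K div 2}"
proof -
  note L = bound_square[OF assms]
  obtain s where s: "even (K + s)" "K \<le> s\<^sup>2" "s\<^sup>2 + (if even K then 2 else 0) \<le> 3 * K"
    using middle_square_exists[OF assms(1)] by blast
  have "s\<^sup>2 \<le> (K - 2 * L)\<^sup>2" using order_trans[OF s(3) L(2)] by (simp only: add_le_cancel_right)
  then have sL: "s \<le> K - 2 * L" by (simp add: power2_nat_le_eq_le)
  \<comment> \<open>The orbit with K - 2b = s; the division is exact by parity, and s at most K - 2L
    gives \<open>L \<le> b\<close>.\<close>
  define b where "b = (K - s) div 2"
  define e where "e = K div 2"
  have b: "2 * b + s = K" using s(1) sL unfolding b_def by presburger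
  have ord: "L \<le> b" "b \<le> e" "2 * e \<le> K" using b sL L(1) unfolding e_def by linarith+
  define m :: real where "m = (if even K then 0 else 1)"
  define c where "c = (real s)\<^sup>2"
  define T where "T = (real (K - 2 * L))\<^sup>2"
  have t: "(2 * real L - real K)\<^sup>2 = T" "(2 * real b - real K)\<^sup>2 = c" "(2 * real e - real K)\<^sup>2 = m"
  proof -
    show "(2 * real L - real K)\<^sup>2 = T"
      using L(1) by (simp add: T_def power2_commute)
    have "real K = 2 * real b + real s" using b by linarith
    then show "(2 * real b - real K)\<^sup>2 = c" by (simp add: c_def)
    have "real K = 2 * real e + (if even K then 0 else 1)"
      unfolding e_def by (auto elim!: evenE oddE)
    then show "(2 * real e - real K)\<^sup>2 = m" by (simp add: m_def)
  qed
  have rK: "real K \<ge> 2" using assms(1) by simp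
  have cK: "real K \<le> c"
    using s(2) by (simp add: c_def flip: of_nat_power)
  have c3: "c \<le> 3 * real K - 2 + 2 * m"
  proof -
    have "real (s\<^sup>2 + (if even K then 2 else 0)) \<le> real (3 * K)"
      using s(3) by (simp only: of_nat_le_iff)
    then show ?thesis by (auto simp: c_def m_def split: if_splits)
  qed
  have T3: "3 * real K - 2 + 2 * m \<le> T"
  proof -
    have "real (3 * K) \<le> real ((K - 2 * L)\<^sup>2 + (if even K then 2 else 0))"
      using L(2) by (simp only: of_nat_le_iff)
    then show ?thesis by (auto simp: T_def m_def split: if_splits)
  qed
  define Q where "Q = 3 * (real K)\<^sup>2 - 2 * real K"
  have m01: "m = 0 \<or> m = 1" by (simp add: m_def)
  \<comment> \<open>At \<open>K\<close>, the chord of the square function from \<open>m\<close> to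
    \<open>u\<close> lies above \<open>Q\<close> exactly by the last product; the identity uses that
    \<open>m\<close> equals its own square. Both chord conditions thus compare \<open>u\<close> with
    3K - 2 + 2m, which separates \<open>c\<close> from \<open>T\<close>.\<close>
  have chord: "(m + u) * real K - m * u = Q + (real K - m) * (u - (3 * real K - 2 + 2 * m))" for u
    using m01 by (auto simp: Q_def algebra_simps power2_eq_square)
  have Km: "real K - m \<ge> 0" using m01 rK by auto
  have "\<exists>p q r. 0 \<le> p \<and> 0 \<le> q \<and> 0 \<le> r \<and> p + q + r = 1
    \<and> p * T + q * c + r * m = real K \<and> p * T\<^sup>2 + q * c\<^sup>2 + r * m\<^sup>2 = Q"
  proof (rule three_point_weights)
    have "real K * 1 \<le> real K * real K" using rK by (intro mult_left_mono) auto
    then show "(real K)\<^sup>2 \<le> Q" by (simp add: Q_def power2_eq_square)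
    show "Q \<le> (m + T) * real K - m * T" unfolding chord using Km T3 by simp
    show "(m + c) * real K - m * c \<le> Q" unfolding chord using Km c3
      by (simp add: mult_nonneg_nonpos)
  qed (use m01 rK cK c3 T3 in auto)
  then obtain p q r where pqr: "0 \<le> p" "0 \<le> q" "0 \<le> r" "p + q + r = 1"
    "p * T + q * c + r * m = real K" "p * T\<^sup>2 + q * c\<^sup>2 + r * m\<^sup>2 = Q" by blast
  \<comment> \<open>The three contributions are added, so that the masses accumulate correctly when
    \<open>L = b\<close>.\<close>
  define v :: "nat \<Rightarrow> real" where
    "v k = (if k = L then p else 0) + (if k = b then q else 0) + (if k = e then r else 0)" for k
  define w where "w k = (v k + v (K - k)) / 2" for k
  have vsum: "(\<Sum>k\<le>K. v k * f k) = p * f L + q * f b + r * f e" for f :: "nat \<Rightarrow> real"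
  proof -
    have "(\<Sum>k\<le>K. v k * f k) = (\<Sum>k\<le>K. (if k = L then p * f k else 0)
        + (if k = b then q * f k else 0) + (if k = e then r * f k else 0))"
      by (intro sum.cong) (auto simp: v_def algebra_simps)
    also have "\<dots> = p * f L + q * f b + r * f e"
      using ord by (simp add: sum.distrib)
    finally show ?thesis .
  qed
  \<comment> \<open>Averaging \<open>v\<close> with its reflection leaves sums of even powers
    unchanged. The cases n = 0, 1, 2 give the total mass and the second and fourth moments.\<close>
  have wsum: "(\<Sum>k\<le>K. w k * ((2 * real k - real K)\<^sup>2) ^ n) = p * T ^ n + q * c ^ n + r * m ^ n" for n
  proof -
    let ?g = "\<lambda>k. ((2 * real k - real K)\<^sup>2) ^ n"
    have "(\<Sum>k\<le>K. v (K - k) * ?g k) = (\<Sum>k\<le>K. v k * ?g k)"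
    proof (rule sum.reindex_bij_witness[of _ "\<lambda>k. K - k" "\<lambda>k. K - k"])
      fix k assume "k \<in> {..K}"
      then have "2 * real (K - k) - real K = - (2 * real k - real K)"
        by (simp)
      then have "(2 * real (K - k) - real K)\<^sup>2 = (2 * real k - real K)\<^sup>2"
        by (simp only: power2_minus)
      then show "v (K - k) * ((2 * real (K - k) - real K)\<^sup>2) ^ n = v (K - k) * ?g k"
        by simp
    qed auto
    moreover have "(\<Sum>k\<le>K. w k * ?g k) = ((\<Sum>k\<le>K. v k * ?g k) + (\<Sum>k\<le>K. v (K - k) * ?g k)) / 2"
      unfolding sum.distrib[symmetric] sum_divide_distrib
      by (intro sum.cong) (auto simp: w_def field_simps)
    ultimately have "(\<Sum>k\<le>K. w k * ?g k) = (\<Sum>k\<le>K. v k * ?g k)" by simp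
    then show ?thesis by (simp add: vsum t)
  qed
  have v0: "v k \<ge> 0" for k using pqr by (simp add: v_def)
  have vpos: "k \<in> {L, b, e}" if "v k > 0" for k
    using that by (auto simp: v_def split: if_splits)
  have wpos: "k \<in> {L, b, e} \<or> K - k \<in> {L, b, e}" if "w k > 0" for k
    using that vpos[of k] vpos[of "K - k"] v0[of k] v0[of "K - k"]
    by (auto simp: w_def) (metis add_0 antisym_conv2 v0)
  show thesis
  proof (rule that[of w b])
    show "0 \<le> w k" for k using v0 by (simp add: w_def)
    show "(\<Sum>k\<le>K. w k) = 1" using wsum[of 0] pqr by simp
    show "w k = w (K - k)" if "k \<le> K" for k using that by (simp add: w_def)
    show "(\<Sum>k\<le>K. w k * (2 * real k - real K)\<^sup>2) = real K" using wsum[of 1] pqr by simp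
    show "(\<Sum>k\<le>K. w k * (2 * real k - real K) ^ 4) = 3 * (real K)\<^sup>2 - 2 * real K"
      using wsum[of 2] pqr by (simp add: Q_def flip: power_mult)
    show "L \<le> k \<and> k \<le> K - L" if "k \<le> K" "w k > 0" for k
      using wpos[OF that(2)] that(1) ord by auto
    \<comment> \<open>If \<open>K - k\<close> is one of the three indices, it is at most K/2; with
      \<open>2 * k \<le> K\<close> this forces \<open>k = K - k\<close>, so no further orbit
      arises.\<close>
    show "k \<in> {L, b, K div 2}" if "2 * k \<le> K" "w k > 0" for k
      using wpos[OF that(2)] that(1) ord unfolding e_def by auto
  qed
qed

theorem theorem1:
  fixes K L :: nat
  assumes "K \<ge> 2" and "real L \<le> bound K"
  shows "\<exists>w \<xi>. symmetric_invariant_design K w \<xi>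
           \<and> design_on (region K L (K - L)) \<xi>
           \<and> card (supporting_orbits K w) \<le> 3
           \<and> (\<forall>S \<in> supporting_orbits K w. S \<subseteq> region K L (K - L))
           \<and> information_matrix K \<xi> = 1\<^sub>m (num_params K)"
proof -
  obtain w b where w: "\<And>k. k \<le> K \<Longrightarrow> 0 \<le> w k" "(\<Sum>k\<le>K. w k) = 1"
    "\<And>k. k \<le> K \<Longrightarrow> w k = w (K - k)"
    "(\<Sum>k\<le>K. w k * (2 * real k - real K)\<^sup>2) = real K"
    "(\<Sum>k\<le>K. w k * (2 * real k - real K) ^ 4) = 3 * (real K)\<^sup>2 - 2 * real K"
    and range: "\<And>k. k \<le> K \<Longrightarrow> w k > 0 \<Longrightarrow> L \<le> k \<and> k \<le> K - L"
    and three: "\<And>k. 2 * k \<le> K \<Longrightarrow> w k > 0 \<Longrightarrow> k \<in> {L, b, K div 2}"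
    using symmetric_weights_exist[OF assms] by blast
  obtain \<xi> where "\<forall>x. pmf \<xi> x = (\<Sum>k\<in>{..K}. w k * pmf (uniform_design K k) x)"
    using mixture_pmf_exists[of "{..K}" w "uniform_design K"] w(1,2) by auto
  then have \<xi>: "symmetric_invariant_design K w \<xi>"
    using w(1-3) unfolding symmetric_invariant_design_def by blast
  have "design_on (region K L (K - L)) \<xi>"
    unfolding design_on_def region_def
    using set_pmf_invariant_design[OF \<xi>] range plus_count_le by blast
  moreover have "card (supporting_orbits K w) \<le> 3"
  proof -
    have "supporting_orbits K w \<subseteq> symmetric_orbit K ` {L, b, K div 2}"
      unfolding supporting_orbits_def using three by blast
    then have "card (supporting_orbits K w) \<le> card {L, b, K div 2}"
      by (meson card_image_le card_mono finite.emptyI finite_imageI finite_insert order_trans)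
    also have "\<dots> \<le> 3" by (simp add: card_insert_if)
    finally show ?thesis .
  qed
  moreover have "S \<subseteq> region K L (K - L)" if S: "S \<in> supporting_orbits K w" for S
  proof -
    obtain k where k: "S = symmetric_orbit K k" "2 * k \<le> K" "w k > 0"
      using S by (auto simp: supporting_orbits_def)
    \<comment> \<open>The interval from \<open>L\<close> to \<open>K - L\<close> is stable under
      reflection, so both halves of the symmetric orbit lie in the region.\<close>
    then show ?thesis
      using range[of k] by (auto simp: symmetric_orbit_def orbit_def region_def)
  qed
  moreover have "information_matrix K \<xi> = 1\<^sub>m (num_params K)"
  \<comment> \<open>Symmetry supplies moments 1 and 3; the choice of \<open>w\<close> supplies
    moments 0, 2 and 4.\<close>
  proof (rule information_matrix_eq_one)
    show "set_pmf \<xi> \<subseteq> cube K" using set_pmf_invariant_design[OF \<xi>] by blast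
    show "pmf \<xi> x = w (plus_count x) / card (orbit K (plus_count x))" if "x \<in> cube K" for x
      using pmf_invariant_design[OF \<xi> that] .
    show "moment K (pmf \<xi>) 1 {} = 0" "moment K (pmf \<xi>) 3 {} = 0"
      by (simp_all add: odd_moment_symmetric_design[OF \<xi>])
  qed (use w(2,4,5) in \<open>simp_all add: moment_invariant_design[OF \<xi>]\<close>)
  ultimately show ?thesis using \<xi> by blast
qed

end
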